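(* For every $d\ge 2$ there is no strategy-proof algorithm (mechanism) that finds a stable matching in the $d$-list model.
   Context: A matching market consists of $n$ men and $n$ women. In the $d$-list model there are $d$ fixed rankings $\pi_1,\dots,\pi_d$ of the women and $d$ fixed rankings $\sigma_1,\dots,\sigma_d$ of the men; each man chooses one of the $\pi_i$ as his preference list and each woman chooses one of the $\sigma_j$ as hers. A matching $\mu$ is stable if there is no pair $(m,w)\notin\mu$ with $m$ preferring $w$ to $\mu(m)$ and $w$ preferring $m$ to $\mu(w)$. A mechanism takes the reported list choices of all participants and outputs a matching stable with respect to the reported preferences. It is strategy-proof if no participant can ever obtain a partner he or she strictly prefers (according to his or her true list) by reporting a different list choice while all others report truthfully; the lists themselves are fixed and only the choice of list can be misreported. *)

theory Defs
  imports "HOL-Combinatorics.Permutations" "HOL-Library.FuncSet"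
begin

text \<open>
  The men and the women of a market of size \<open>n\<close> are both numbered by \<open>{..<n}\<close>. A ranking is given
  by its position function, a permutation of \<open>{..<n}\<close>; position \<open>0\<close> is the most preferred one.
\<close>

definition prefers :: "(nat \<Rightarrow> nat) \<Rightarrow> nat \<Rightarrow> nat \<Rightarrow> bool" where
  "prefers r x y \<longleftrightarrow> r x < r y"

text \<open>
  \<open>\<pi>\<close> are the rankings of the women (held by men), \<open>\<sigma>\<close> the rankings of the men (held by women),
  both indexed from \<open>0\<close>. The \<open>d\<close> lists of each side are required to be different; admitting
  repetitions would only enlarge the class of markets an algorithm has to handle.
\<close>

definition list_market :: "nat \<Rightarrow> nat \<Rightarrow> (nat \<Rightarrow> nat \<Rightarrow> nat) \<Rightarrow> (nat \<Rightarrow> nat \<Rightarrow> nat) \<Rightarrow> bool" where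
  "list_market d n \<pi> \<sigma> \<longleftrightarrow>
     (\<forall>i<d. \<pi> i permutes {..<n}) \<and> inj_on \<pi> {..<d} \<and>
     (\<forall>j<d. \<sigma> j permutes {..<n}) \<and> inj_on \<sigma> {..<d}"

text \<open>Assignments of a list index to each of the \<open>n\<close> participants of one side.\<close>

definition choices :: "nat \<Rightarrow> nat \<Rightarrow> (nat \<Rightarrow> nat) set" where
  "choices d n = {..<n} \<rightarrow>\<^sub>E {..<d}"

text \<open>A matching \<open>\<mu>\<close> maps men to women; the partner of the woman \<open>w\<close> is \<open>inv \<mu> w\<close>.\<close>

definition stable ::
  "nat \<Rightarrow> (nat \<Rightarrow> nat \<Rightarrow> nat) \<Rightarrow> (nat \<Rightarrow> nat \<Rightarrow> nat) \<Rightarrow> (nat \<Rightarrow> nat) \<Rightarrow> (nat \<Rightarrow> nat) \<Rightarrow> (nat \<Rightarrow> nat) \<Rightarrow> bool"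
where
  "stable n \<pi> \<sigma> a b \<mu> \<longleftrightarrow>
     \<mu> permutes {..<n} \<and>
     \<not> (\<exists>m<n. \<exists>w<n. \<mu> m \<noteq> w \<and>
          prefers (\<pi> (a m)) w (\<mu> m) \<and> prefers (\<sigma> (b w)) m (inv \<mu> w))"

text \<open>A mechanism maps the reported choices of the men and of the women to a matching.\<close>

type_synonym mechanism = "(nat \<Rightarrow> nat) \<Rightarrow> (nat \<Rightarrow> nat) \<Rightarrow> nat \<Rightarrow> nat"

definition finds_stable ::
  "nat \<Rightarrow> nat \<Rightarrow> (nat \<Rightarrow> nat \<Rightarrow> nat) \<Rightarrow> (nat \<Rightarrow> nat \<Rightarrow> nat) \<Rightarrow> mechanism \<Rightarrow> bool" where
  "finds_stable d n \<pi> \<sigma> M \<longleftrightarrow>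
     (\<forall>a\<in>choices d n. \<forall>b\<in>choices d n. stable n \<pi> \<sigma> a b (M a b))"

text \<open>
  Here \<open>a\<close>, \<open>b\<close> are the true choices and \<open>k\<close> is the list reported by the single deviating
  participant, who compares outcomes by his or her true list.
\<close>

definition strategy_proof ::
  "nat \<Rightarrow> nat \<Rightarrow> (nat \<Rightarrow> nat \<Rightarrow> nat) \<Rightarrow> (nat \<Rightarrow> nat \<Rightarrow> nat) \<Rightarrow> mechanism \<Rightarrow> bool" where
  "strategy_proof d n \<pi> \<sigma> M \<longleftrightarrow>
     (\<forall>a\<in>choices d n. \<forall>b\<in>choices d n.
        (\<forall>m<n. \<forall>k<d. \<not> prefers (\<pi> (a m)) (M (a(m := k)) b m) (M a b m)) \<and>
        (\<forall>w<n. \<forall>k<d. \<not> prefers (\<sigma> (b w)) (inv (M a (b(w := k))) w) (inv (M a b) w)))"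

end

theory Submission
  imports Defs
begin

text \<open>
  The market has five essential men and women, and the numbers from \<open>5\<close> on come last in their
  rankings. Man \<open>0\<close> and the women \<open>2\<close>, \<open>3\<close> hold list \<open>1\<close>, everybody else holds list \<open>0\<close>, the natural
  order. A stable matching cannot give both man \<open>1\<close> and woman \<open>2\<close> their first choices (woman \<open>0\<close> and
  man \<open>2\<close>). But if man \<open>1\<close> reports list \<open>1\<close>, every stable matching gives him woman \<open>0\<close>, and if woman
  \<open>2\<close> reports list \<open>0\<close>, every stable matching gives her man \<open>2\<close>. So one of the two gains by lying.
\<close>

text \<open>The transpositions only make the \<open>d\<close> lists distinct; nobody has to report them.\<close>

definition market_lists :: "(nat \<Rightarrow> nat) \<Rightarrow> nat \<Rightarrow> nat \<Rightarrow> nat" where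
  "market_lists f k = (if k = 0 then id else if k = 1 then f else transpose (k + 3) (k + 4))"

text \<open>Men reporting list \<open>1\<close> rank the women \<open>3, 0, 2, 4, 1, 5, 6, \<dots>\<close>; women reporting list \<open>1\<close>
  rank the men \<open>2, 4, 0, 3, 1, 5, 6, \<dots>\<close>.\<close>

definition men_list1 :: "nat \<Rightarrow> nat" where
  "men_list1 = transpose 0 1 \<circ> transpose 1 4 \<circ> transpose 4 3"

definition women_list1 :: "nat \<Rightarrow> nat" where
  "women_list1 = transpose 0 2 \<circ> transpose 1 4"

abbreviation men_lists :: "nat \<Rightarrow> nat \<Rightarrow> nat" where
  "men_lists \<equiv> market_lists men_list1"

abbreviation women_lists :: "nat \<Rightarrow> nat \<Rightarrow> nat" where
  "women_lists \<equiv> market_lists women_list1"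

lemma market_lists_0 [simp]: "market_lists f 0 x = x"
  and market_lists_1 [simp]: "market_lists f (Suc 0) = f"
  by (simp_all add: market_lists_def)

lemma men_list1_apply:
  "men_list1 x =
    (if x = 0 then 1 else if x = 1 then 4 else if x = 3 then 0 else if x = 4 then 3 else x)"
  by (simp add: men_list1_def transpose_def)

lemma women_list1_apply:
  "women_list1 x =
    (if x = 0 then 2 else if x = 1 then 4 else if x = 2 then 0 else if x = 4 then 1 else x)"
  by (simp add: women_list1_def transpose_def)

lemma men_list1_permutes: "5 \<le> n \<Longrightarrow> men_list1 permutes {..<n}"
  unfolding men_list1_def by (intro permutes_compose permutes_swap_id) auto

lemma women_list1_permutes: "5 \<le> n \<Longrightarrow> women_list1 permutes {..<n}"
  unfolding women_list1_def by (intro permutes_compose permutes_swap_id) auto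

lemma market_lists_permutes:
  assumes "f permutes {..<n}" "k + 4 < n"
  shows "market_lists f k permutes {..<n}"
  using assms by (auto simp: market_lists_def permutes_id intro!: permutes_swap_id)

text \<open>List \<open>1\<close> differs from list \<open>0\<close> at \<open>0\<close>. For
  \<open>j \<ge> 2\<close>, list \<open>j\<close> moves \<open>j + 4\<close>, which every list of
  smaller index fixes.\<close>

lemma market_lists_inj:
  assumes "f 0 \<noteq> 0" and f_fix: "\<And>x. 5 \<le> x \<Longrightarrow> f x = x"
  shows "inj (market_lists f)"
proof -
  have less: "market_lists f i \<noteq> market_lists f j" if "i < j" for i j
  proof (cases "j = 1")
    case True
    with that have "market_lists f i 0 = 0" "market_lists f j 0 \<noteq> 0"
      using assms(1) by auto
    then show ?thesis by auto
  next
    case False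
    have "market_lists f j (j + 4) = j + 3"
      using that False by (simp add: market_lists_def)
    moreover have "market_lists f i (j + 4) = j + 4"
      using that False by (simp add: market_lists_def f_fix transpose_def)
    ultimately show ?thesis by auto
  qed
  then show ?thesis
    by (metis injI linorder_neqE_nat)
qed

text \<open>Size \<open>d + 4\<close> keeps the transposed points \<open>k + 3\<close> and
  \<open>k + 4\<close> inside the market for all \<open>k < d\<close>.\<close>

lemma list_market_example: "list_market d (d + 4) men_lists women_lists" if "d \<ge> 2"
proof -
  have "inj men_lists" "inj women_lists"
    by (auto intro!: market_lists_inj simp: men_list1_apply women_list1_apply)
  then show ?thesis
    using that unfolding list_market_def
    by (auto intro!: market_lists_permutes men_list1_permutes women_list1_permutes
        intro: inj_on_subset)
qed

lemma stable_no_blocking_pair: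
  assumes "stable n \<pi> \<sigma> a b \<mu>" "m < n" "w < n"
    "\<pi> (a m) w < \<pi> (a m) (\<mu> m)"
  shows "\<sigma> (b w) (inv \<mu> w) \<le> \<sigma> (b w) m"
  using assms unfolding stable_def prefers_def by (metis not_le less_irrefl)

lemma stable_inv_eq_iff:
  assumes "stable n \<pi> \<sigma> a b \<mu>"
  shows "inv \<mu> w = m \<longleftrightarrow> \<mu> m = w"
  using assms unfolding stable_def by (metis permutes_inverses)

text \<open>If both had their first choices, woman \<open>1\<close>, whom man \<open>2\<close>
  prefers to woman \<open>2\<close>, would have to hold man \<open>0\<close>. She is last among his
  first five, so he would block with woman \<open>0\<close>, who ranks him above man
  \<open>1\<close>.\<close>

lemma truthful_stable:
  assumes st: "stable n men_lists women_lists a b \<mu>" and n: "5 \<le> n"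
    and a: "a 0 = 1" "a 2 = 0" and b: "b 0 = 0" "b 1 = 0"
    and \<mu>: "\<mu> 1 = 0"
  shows "\<mu> 2 \<noteq> 2"
proof
  assume "\<mu> 2 = 2"
  note block = stable_no_blocking_pair[OF st] and inv = stable_inv_eq_iff[OF st]
  have "inv \<mu> 1 \<le> 2"
    using block[of 2 1] n a b \<open>\<mu> 2 = 2\<close> by simp
  then consider "inv \<mu> 1 = 0" | "inv \<mu> 1 = 1" | "inv \<mu> 1 = 2" by linarith
  then have "\<mu> 0 = 1"
    using \<mu> \<open>\<mu> 2 = 2\<close> by cases (auto simp: inv)
  then have "inv \<mu> 0 = 0"
    using block[of 0 0] n a b by (simp add: men_list1_apply)
  then show False
    using \<open>\<mu> 0 = 1\<close> by (simp add: inv)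
qed

text \<open>If man \<open>0\<close> had woman \<open>3\<close>, the common order would push man
  \<open>4\<close> below woman \<open>3\<close>, who prefers him to man \<open>0\<close>. So man
  \<open>0\<close> gets woman \<open>0\<close>, and the common order then pairs \<open>1\<close>
  with \<open>1\<close> and \<open>2\<close> with \<open>2\<close>.\<close>

lemma misreport_woman_stable:
  assumes st: "stable n men_lists women_lists a b \<mu>" and n: "5 \<le> n"
    and a: "a 0 = 1" "a 1 = 0" "a 2 = 0" "a 3 = 0" "a 4 = 0"
    and b: "b 0 = 0" "b 1 = 0" "b 2 = 0" "b 3 = 1"
  shows "\<mu> 2 = 2"
proof -
  note block = stable_no_blocking_pair[OF st] and inv = stable_inv_eq_iff[OF st]
  text \<open>Serial dictatorship in the natural order, which both sides share here.\<close>
  have next_pair: "\<mu> m = w"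
    if "m < 5" "w < 5" "a m = 0" "b w = 0" and taken: "\<forall>v<w. inv \<mu> v < m" "\<forall>k<m. \<mu> k \<noteq> w"
    for m w
  proof (rule ccontr)
    assume "\<mu> m \<noteq> w"
    \<comment> \<open>All women before \<open>w\<close> are held by men before \<open>m\<close>, so
      man \<open>m\<close> would prefer \<open>w\<close> to his partner.\<close>
    moreover have "\<not> \<mu> m < w"
      using taken(1) inv[of "\<mu> m" m] by (metis less_irrefl)
    ultimately have "inv \<mu> w \<le> m"
      using block[of m w] that n by simp
    moreover have "inv \<mu> w \<noteq> m" "\<mu> (inv \<mu> w) = w"
      using \<open>\<mu> m \<noteq> w\<close> inv by blast+
    ultimately show False
      using taken(2) by (metis le_neq_implies_less)
  qed
  have "\<mu> 0 \<noteq> 3"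
  proof
    assume 0: "\<mu> 0 = 3"
    have 1: "\<mu> 1 = 0"
      using next_pair[of 1 0] a b 0 by simp
    then have 2: "\<mu> 2 = 1"
      using next_pair[of 2 1] a b 0 inv[of 0 1] by (simp add: numeral_eq_Suc All_less_Suc)
    then have 3: "\<mu> 3 = 2"
      using next_pair[of 3 2] a b 0 1 inv[of 0 1] inv[of 1 2]
      by (simp add: numeral_eq_Suc All_less_Suc)
    \<comment> \<open>These women are taken, so man \<open>4\<close> prefers woman \<open>3\<close>
      to his partner.\<close>
    have "\<mu> 4 \<notin> {0, 1, 2, 3}"
      using 0 1 2 3 inv[of 0 1] inv[of 0 4] inv[of 1 2] inv[of 1 4] inv[of 2 3] inv[of 2 4]
        inv[of 3 0] inv[of 3 4] by auto
    then have "women_list1 (inv \<mu> 3) \<le> women_list1 4"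
      using block[of 4 3] n a b by simp
    moreover have "inv \<mu> 3 = 0" using 0 by (simp add: inv)
    ultimately show False by (simp add: women_list1_apply)
  qed
  have 0: "\<mu> 0 = 0"
  proof (rule ccontr)
    assume "\<mu> 0 \<noteq> 0"
    with \<open>\<mu> 0 \<noteq> 3\<close> have "1 < men_list1 (\<mu> 0)" by (simp add: men_list1_apply)
    then have "inv \<mu> 0 = 0"
      using block[of 0 0] n a b by (simp add: men_list1_apply)
    with \<open>\<mu> 0 \<noteq> 0\<close> show False by (simp add: inv)
  qed
  then have 1: "\<mu> 1 = 1"
    using next_pair[of 1 1] a b inv[of 0 0] by simp
  show ?thesis
    using next_pair[of 2 2] a b 0 1 inv[of 0 0] inv[of 1 1]
    by (simp add: numeral_eq_Suc All_less_Suc)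
qed

text \<open>Denying man \<open>1\<close> woman \<open>0\<close> forces the pairs (man, woman)
  \<open>(0, 0)\<close>, \<open>(4, 3)\<close>, \<open>(2, 2)\<close>, \<open>(1, 1)\<close> in
  turn; then man \<open>1\<close> and woman \<open>4\<close> block.\<close>

lemma misreport_man_stable:
  assumes st: "stable n men_lists women_lists a b \<mu>" and n: "5 \<le> n"
    and a: "a 0 = 1" "a 1 = 1" "a 2 = 0" "a 4 = 0"
    and b: "b 0 = 0" "b 1 = 0" "b 2 = 1" "b 3 = 1" "b 4 = 0"
  shows "\<mu> 1 = 0"
proof (rule ccontr)
  assume 1: "\<mu> 1 \<noteq> 0"
  note block = stable_no_blocking_pair[OF st] and inv = stable_inv_eq_iff[OF st]
  have 13: "\<mu> 1 \<noteq> 3"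
  proof
    assume "\<mu> 1 = 3"
    then have "inv \<mu> 3 = 1" by (simp add: inv)
    then have "\<mu> 0 \<noteq> 3" using inv[of 3 0] by auto
    then have "0 < men_list1 (\<mu> 0)" by (simp add: men_list1_apply)
    then have "women_list1 (inv \<mu> 3) \<le> women_list1 0"
      using block[of 0 3] n a b by (simp add: men_list1_apply)
    with \<open>inv \<mu> 3 = 1\<close> show False by (simp add: women_list1_apply)
  qed
  \<comment> \<open>Only woman \<open>3\<close> is above woman \<open>0\<close> on list
    \<open>1\<close>, so man \<open>1\<close> prefers woman \<open>0\<close> to his partner.\<close>
  have "inv \<mu> 0 \<le> 1"
    using block[of 1 0] 1 13 n a b by (auto simp: men_list1_apply split: if_splits)
  with 1 have "inv \<mu> 0 = 0"
    using inv[of 0 1] by (cases "inv \<mu> 0") auto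
  then have 0: "\<mu> 0 = 0" by (simp add: inv)
  \<comment> \<open>Man \<open>0\<close> still prefers woman \<open>3\<close>, so she holds someone
    she ranks no lower than him, whose position is \<open>2\<close>.\<close>
  have "women_list1 (inv \<mu> 3) \<le> 2"
    using block[of 0 3] 0 n a b by (simp add: men_list1_apply women_list1_apply)
  then have "inv \<mu> 3 \<in> {0, 2, 4}"
    by (auto simp: women_list1_apply split: if_splits)
  then have "\<mu> 2 = 3 \<or> \<mu> 4 = 3"
    using 0 by (auto simp: inv)
  moreover have "\<mu> 2 \<noteq> 3"
  proof
    assume "\<mu> 2 = 3"
    then have "inv \<mu> 2 = 2"
      using block[of 2 2] n a b by (auto simp: women_list1_apply split: if_splits)
    with \<open>\<mu> 2 = 3\<close> show False by (simp add: inv)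
  qed
  ultimately have 4: "\<mu> 4 = 3" by blast
  then have "inv \<mu> 2 \<in> {2, 4}"
    using block[of 4 2] n a b by (auto simp: women_list1_apply split: if_splits)
  with 4 have 2: "\<mu> 2 = 2" by (auto simp: inv)
  have "inv \<mu> 1 \<le> 2"
    using block[of 2 1] 2 n a b by simp
  then consider "inv \<mu> 1 = 0" | "inv \<mu> 1 = 1" | "inv \<mu> 1 = 2" by linarith
  then have 1: "\<mu> 1 = 1"
    using 0 2 by cases (auto simp: inv)
  \<comment> \<open>On list \<open>1\<close> woman \<open>4\<close> is just above woman
    \<open>1\<close>.\<close>
  then have "inv \<mu> 4 \<le> 1"
    using block[of 1 4] n a b by (simp add: men_list1_apply)
  then consider "inv \<mu> 4 = 0" | "inv \<mu> 4 = 1" by linarith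
  then show False
    using 0 1 by cases (auto simp: inv)
qed

theorem theorem3:
  fixes d :: nat
  assumes "d \<ge> 2"
  shows "\<not> (\<exists>A :: nat \<Rightarrow> (nat \<Rightarrow> nat \<Rightarrow> nat) \<Rightarrow> (nat \<Rightarrow> nat \<Rightarrow> nat) \<Rightarrow> mechanism.
    \<forall>n \<pi> \<sigma>. list_market d n \<pi> \<sigma> \<longrightarrow>
      finds_stable d n \<pi> \<sigma> (A n \<pi> \<sigma>) \<and> strategy_proof d n \<pi> \<sigma> (A n \<pi> \<sigma>))"
proof
  assume "\<exists>A :: nat \<Rightarrow> (nat \<Rightarrow> nat \<Rightarrow> nat) \<Rightarrow> (nat \<Rightarrow> nat \<Rightarrow> nat) \<Rightarrow> mechanism.
    \<forall>n \<pi> \<sigma>. list_market d n \<pi> \<sigma> \<longrightarrow>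
      finds_stable d n \<pi> \<sigma> (A n \<pi> \<sigma>) \<and> strategy_proof d n \<pi> \<sigma> (A n \<pi> \<sigma>)"
  then obtain M where finds: "finds_stable d (d + 4) men_lists women_lists M"
    and sp: "strategy_proof d (d + 4) men_lists women_lists M"
    using list_market_example[OF assms] by blast
  define a where "a = (\<lambda>m\<in>{..<d + 4}. if m = 0 then 1 else 0 :: nat)"
  define b where "b = (\<lambda>w\<in>{..<d + 4}. if w = 2 \<or> w = 3 then 1 else 0 :: nat)"
  have choices: "a \<in> choices d (d + 4)" "a(1 := 1) \<in> choices d (d + 4)"
    "b \<in> choices d (d + 4)" "b(2 := 0) \<in> choices d (d + 4)"
    using assms by (auto simp: choices_def a_def b_def PiE_iff extensional_def)
  have stable: "stable (d + 4) men_lists women_lists a' b' (M a' b')"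
    if "a' \<in> choices d (d + 4)" "b' \<in> choices d (d + 4)" for a' b'
    using finds that by (simp add: finds_stable_def)
  have n: "5 \<le> d + 4" using assms by simp
  have a: "a 0 = 1" "a 1 = 0" "a 2 = 0" "a 3 = 0" "a 4 = 0"
    and b: "b 0 = 0" "b 1 = 0" "b 2 = 1" "b 3 = 1" "b 4 = 0"
    using assms by (simp_all add: a_def b_def)
  have man: "M (a(1 := 1)) b 1 = 0"
    by (rule misreport_man_stable[OF stable n]) (use choices a b in auto)
  have "M a (b(2 := 0)) 2 = 2"
    by (rule misreport_woman_stable[OF stable n]) (use choices a b in auto)
  then have woman: "inv (M a (b(2 := 0))) 2 = 2"
    using stable_inv_eq_iff[OF stable] choices by blast
  have "\<not> prefers (men_lists (a 1)) (M (a(1 := 1)) b 1) (M a b 1)"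
    using sp choices assms unfolding strategy_proof_def by simp
  \<comment> \<open>The lie yields position \<open>0\<close> of his true list, so not gaining means
    having that partner already; the same argument serves woman \<open>2\<close>.\<close>
  with man a have "M a b 1 = 0" by (simp add: prefers_def)
  have "\<not> prefers (women_lists (b 2)) (inv (M a (b(2 := 0))) 2) (inv (M a b) 2)"
    using sp choices assms unfolding strategy_proof_def by simp
  with woman b have "inv (M a b) 2 = 2"
    by (auto simp: prefers_def women_list1_apply split: if_splits)
  then have "M a b 2 = 2"
    using stable_inv_eq_iff[OF stable] choices by blast
  moreover have "M a b 2 \<noteq> 2"
    by (rule truthful_stable[OF stable n]) (use choices a b \<open>M a b 1 = 0\<close> in auto)
  ultimately show False by blast
qed

end
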